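(* Let $k\ge2$ and $m\ge1$ be integers, and let $c\in(0,1/2)$. Consider a (simple) bipartite graph with bipartition $(A,B)$, where $B$ is partitioned into $k$ blocks $B_1,\ldots,B_k$ each of cardinality $m$, every vertex in $B$ has the same degree $r\ge1$, and each vertex in $A$ has at most $cm$ neighbors in each $B_i$. Let $n=|A|$. Then there is a chain of sets $\emptyset\subsetneq A_1\subsetneq\cdots\subsetneq A_n=A$ such that for all $i_1,i_2\in\{1,\ldots,k\}$ and all $j\in\{1,\ldots,n\}$, \[\big|\,|N(A_j,B_{i_1})|-|N(A_j,B_{i_2})|\,\big|\le\sqrt{2(k-1)c}\cdot m.\]
   Context: For $S\subseteq A$ and $i\in\{1,\ldots,k\}$, $N(S,B_i)$ denotes the set of vertices in $B_i$ that have at least one neighbor in $S$. *)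

theory Defs
  imports Complex_Main "HOL-Library.Disjoint_Sets"
begin

definition simple_graph :: "'v set \<Rightarrow> 'v set set \<Rightarrow> bool" where
  "simple_graph V E \<longleftrightarrow> finite V \<and> (\<forall>e\<in>E. e \<subseteq> V \<and> card e = 2)"

definition bipartite_graph :: "'v set \<Rightarrow> 'v set \<Rightarrow> 'v set set \<Rightarrow> bool" where
  "bipartite_graph A B E \<longleftrightarrow>
     simple_graph (A \<union> B) E \<and> A \<inter> B = {} \<and> (\<forall>e\<in>E. \<exists>a\<in>A. \<exists>b\<in>B. e = {a, b})"

definition degree :: "'v set set \<Rightarrow> 'v \<Rightarrow> nat" where
  "degree E v = card {e \<in> E. v \<in> e}"

definition nbrs :: "'v set set \<Rightarrow> 'v set \<Rightarrow> 'v set \<Rightarrow> 'v set" where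
  "nbrs E S T = {t \<in> T. \<exists>s\<in>S. {s, t} \<in> E}"

end

theory Submission imports Defs begin

text \<open>
  Let \<open>x\<^sub>i = |N(S, B\<^sub>i)|\<close> and choose the next vertex greedily so as to keep the dispersion
  \<open>\<Sum>\<^sub>i (x\<^sub>i - mean)\<^sup>2\<close> at most \<open>(k - 1) c m\<^sup>2\<close>. Each uncovered vertex of \<open>B\<^sub>i\<close> has all its \<open>r\<close>
  neighbours outside \<open>S\<close>, so the gains in coordinate \<open>i\<close> sum to \<open>r (m - x\<^sub>i)\<close> over \<open>A - S\<close>:
  on average the step points towards the diagonal, and this drift outweighs the second-order
  term, which is controlled by the bound \<open>c m\<close> on a single gain. Averaging over \<open>A - S\<close>
  yields a vertex that preserves the bound.
\<close>

section \<open>Dispersion as a quadratic form\<close>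

text \<open>This is \<open>card I\<close> times the covariance of \<open>x\<close> and
  \<open>y\<close> under the uniform distribution on \<open>I\<close>. The two-argument form makes
  the effect of a step expand like a square, with a cross term linear in the step.\<close>

definition codisp :: "'i set \<Rightarrow> ('i \<Rightarrow> real) \<Rightarrow> ('i \<Rightarrow> real) \<Rightarrow> real" where
  "codisp I x y = (\<Sum>i\<in>I. x i * y i) - (\<Sum>i\<in>I. x i) * (\<Sum>i\<in>I. y i) / real (card I)"

lemma codisp_add_self:
  "codisp I (\<lambda>i. x i + y i) (\<lambda>i. x i + y i) = codisp I x x + 2 * codisp I x y + codisp I y y"
proof -
  have "(\<Sum>i\<in>I. (x i + y i) * (x i + y i))
      = (\<Sum>i\<in>I. x i * x i) + 2 * (\<Sum>i\<in>I. x i * y i) + (\<Sum>i\<in>I. y i * y i)"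
    by (simp add: algebra_simps sum.distrib sum_distrib_left)
  then show ?thesis
    unfolding codisp_def sum.distrib by (simp add: algebra_simps add_divide_distrib)
qed

lemma codisp_sum_right:
  "codisp I x (\<lambda>i. \<Sum>a\<in>R. g a i) = (\<Sum>a\<in>R. codisp I x (g a))"
proof -
  have 1: "(\<Sum>i\<in>I. x i * (\<Sum>a\<in>R. g a i)) = (\<Sum>a\<in>R. \<Sum>i\<in>I. x i * g a i)"
    by (subst sum.swap) (simp add: sum_distrib_left)
  have 2: "(\<Sum>i\<in>I. \<Sum>a\<in>R. g a i) = (\<Sum>a\<in>R. \<Sum>i\<in>I. g a i)"
    by (rule sum.swap)
  show ?thesis
    unfolding codisp_def 1 2 by (simp add: sum_subtractf sum_distrib_left sum_divide_distrib)
qed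

text \<open>Constant vectors have zero covariance with everything, so the \<open>r * m\<close> part
  vanishes. The negative sign is the pull towards the diagonal.\<close>

lemma codisp_affine_right:
  assumes "finite I" "I \<noteq> {}"
  shows "codisp I x (\<lambda>i. r * (m - x i)) = - r * codisp I x x"
proof -
  have 1: "(\<Sum>i\<in>I. x i * (r * (m - x i))) = r * m * (\<Sum>i\<in>I. x i) - r * (\<Sum>i\<in>I. x i * x i)"
    by (simp add: algebra_simps sum_subtractf sum_distrib_left)
  have 2: "(\<Sum>i\<in>I. r * (m - x i)) = r * m * real (card I) - r * (\<Sum>i\<in>I. x i)"
    by (simp add: algebra_simps sum_subtractf sum_distrib_left)
  have "real (card I) \<noteq> 0" using assms by simp
  then show ?thesis unfolding codisp_def 1 2 by (simp add: field_simps)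
qed

lemma codisp_self_eq_sum_squares:
  assumes "finite I" "I \<noteq> {}"
  shows "codisp I x x = (\<Sum>i\<in>I. (x i - (\<Sum>j\<in>I. x j) / real (card I))\<^sup>2)"
proof -
  define \<mu> where "\<mu> = (\<Sum>j\<in>I. x j) / real (card I)"
  have s: "(\<Sum>j\<in>I. x j) = \<mu> * real (card I)" using assms by (simp add: \<mu>_def)
  have "(\<Sum>i\<in>I. (x i - \<mu>)\<^sup>2) = (\<Sum>i\<in>I. x i * x i - 2 * \<mu> * x i + \<mu>\<^sup>2)"
    by (simp add: power2_eq_square algebra_simps)
  also have "\<dots> = (\<Sum>i\<in>I. x i * x i) - 2 * \<mu> * (\<Sum>i\<in>I. x i) + real (card I) * \<mu>\<^sup>2"
    by (simp add: sum.distrib sum_subtractf sum_distrib_left)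
  also have "\<dots> = codisp I x x"
    unfolding codisp_def s using assms by (simp add: power2_eq_square algebra_simps)
  finally show ?thesis by (simp add: \<mu>_def)
qed

lemma codisp_self_nonneg:
  assumes "finite I" "I \<noteq> {}"
  shows "0 \<le> codisp I x x"
  using assms by (simp add: codisp_self_eq_sum_squares sum_nonneg)

text \<open>With u and v the deviations of \<open>x p\<close> and \<open>x q\<close> from the mean,
  (u - v)^2 <= 2 (u^2 + v^2), and u^2 + v^2 is part of the dispersion. This is the source of the 2
  under the final square root.\<close>

lemma diff_squared_le_codisp:
  assumes "finite I" "p \<in> I" "q \<in> I"
  shows "(x p - x q)\<^sup>2 \<le> 2 * codisp I x x"
proof (cases "p = q")
  case True
  then show ?thesis using assms codisp_self_nonneg[of I x] by auto
next
  case False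
  define \<mu> where "\<mu> = (\<Sum>j\<in>I. x j) / real (card I)"
  have "I \<noteq> {}" using assms by auto
  have "(x p - \<mu>)\<^sup>2 + (x q - \<mu>)\<^sup>2 = (\<Sum>i\<in>{p, q}. (x i - \<mu>)\<^sup>2)"
    using False by simp
  also have "\<dots> \<le> (\<Sum>i\<in>I. (x i - \<mu>)\<^sup>2)"
    by (rule sum_mono2) (use assms in auto)
  also have "\<dots> = codisp I x x"
    using \<open>finite I\<close> \<open>I \<noteq> {}\<close> by (simp add: codisp_self_eq_sum_squares \<mu>_def)
  finally have "(x p - \<mu>)\<^sup>2 + (x q - \<mu>)\<^sup>2 \<le> codisp I x x" .
  moreover have "0 \<le> ((x p - \<mu>) + (x q - \<mu>))\<^sup>2" by simp
  ultimately show ?thesis by (simp add: power2_eq_square algebra_simps)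
qed

text \<open>For nonnegative entries the square of the sum dominates the sum of squares, so the
  subtracted mean term removes at least the fraction \<open>1 / card I\<close> of the latter. This
  saving turns a factor k into k - 1.\<close>

lemma codisp_self_le:
  assumes "finite I" "I \<noteq> {}" "\<And>i. i \<in> I \<Longrightarrow> 0 \<le> y i"
  shows "codisp I y y \<le> (1 - 1 / real (card I)) * (\<Sum>i\<in>I. y i * y i)"
proof -
  have "(\<Sum>i\<in>I. y i * y i) \<le> (\<Sum>i\<in>I. y i * (\<Sum>j\<in>I. y j))"
    by (intro sum_mono mult_left_mono member_le_sum) (use assms in auto)
  also have "\<dots> = (\<Sum>i\<in>I. y i) * (\<Sum>i\<in>I. y i)"
    by (simp add: sum_distrib_right)
  finally have "(\<Sum>i\<in>I. y i * y i) / real (card I) \<le> (\<Sum>i\<in>I. y i) * (\<Sum>i\<in>I. y i) / real (card I)"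
    by (rule divide_right_mono) simp
  then show ?thesis unfolding codisp_def by (simp add: algebra_simps)
qed

section \<open>The averaging step\<close>

text \<open>If every choice in \<open>R\<close> exceeded the bound, so would their average; but the
  sum of the new dispersions over \<open>R\<close> is at most \<open>card R\<close> times the
  bound.\<close>

lemma ex_step_codisp_le:
  fixes g :: "'a \<Rightarrow> 'i \<Rightarrow> real"
  assumes I: "finite I" "I \<noteq> {}" and R: "finite R" "R \<noteq> {}"
    and g: "\<And>a i. a \<in> R \<Longrightarrow> i \<in> I \<Longrightarrow> 0 \<le> g a i" "\<And>a i. a \<in> R \<Longrightarrow> i \<in> I \<Longrightarrow> g a i \<le> d"
    and drift: "\<And>i. i \<in> I \<Longrightarrow> (\<Sum>a\<in>R. g a i) = r * (m - x i)"
    and x: "\<And>i. i \<in> I \<Longrightarrow> 0 \<le> x i"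
    and nonneg: "0 \<le> r" "0 \<le> m" "0 \<le> d" and r: "r \<le> real (card R)"
    and bound: "codisp I x x \<le> (real (card I) - 1) * d * m"
  shows "\<exists>a\<in>R. codisp I (\<lambda>i. x i + g a i) (\<lambda>i. x i + g a i) \<le> (real (card I) - 1) * d * m"
proof (rule ccontr)
  define M where "M = (real (card I) - 1) * d * m"
  define Q where "Q = codisp I x x"
  define N where "N = real (card R)"
  have k: "real (card I) \<ge> 1" using I by (simp add: Suc_le_eq card_gt_0_iff)
  have M0: "0 \<le> M" using k nonneg by (simp add: M_def)
  have Q0: "0 \<le> Q" unfolding Q_def by (rule codisp_self_nonneg[OF I])
  have QM: "Q \<le> M" using bound by (simp add: Q_def M_def)
  \<comment> \<open>Second-order term: each square \<open>g a i * g a i\<close> is at most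
    \<open>d * g a i\<close>, and the total gain in each coordinate is at most \<open>r * m\<close>
    because \<open>x i\<close> is nonnegative.\<close>
  have "(\<Sum>a\<in>R. codisp I (g a) (g a))
      \<le> (\<Sum>a\<in>R. (1 - 1 / real (card I)) * (\<Sum>i\<in>I. d * g a i))"
  proof (rule sum_mono)
    fix a assume a: "a \<in> R"
    have "codisp I (g a) (g a) \<le> (1 - 1 / real (card I)) * (\<Sum>i\<in>I. g a i * g a i)"
      using I a g by (intro codisp_self_le) auto
    also have "\<dots> \<le> (1 - 1 / real (card I)) * (\<Sum>i\<in>I. d * g a i)"
      using k a g by (intro mult_left_mono sum_mono mult_right_mono) auto
    finally show "codisp I (g a) (g a) \<le> (1 - 1 / real (card I)) * (\<Sum>i\<in>I. d * g a i)" .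
  qed
  also have "\<dots> = (1 - 1 / real (card I)) * (\<Sum>i\<in>I. d * (\<Sum>a\<in>R. g a i))"
    unfolding sum_distrib_left by (subst sum.swap) (rule refl)
  also have "\<dots> \<le> (1 - 1 / real (card I)) * (\<Sum>i\<in>I. d * (r * m))"
    using k nonneg drift x by (intro mult_left_mono sum_mono) (auto intro!: mult_left_mono)
  also have "\<dots> = r * M"
    using k by (simp add: M_def field_simps)
  finally have second: "(\<Sum>a\<in>R. codisp I (g a) (g a)) \<le> r * M" .
  have "codisp I x (\<lambda>i. \<Sum>a\<in>R. g a i) = codisp I x (\<lambda>i. r * (m - x i))"
    using drift by (simp add: codisp_def)
  then have first: "(\<Sum>a\<in>R. codisp I x (g a)) = - r * Q"
    using I by (simp add: codisp_sum_right codisp_affine_right Q_def)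
  have "(\<Sum>a\<in>R. codisp I (\<lambda>i. x i + g a i) (\<lambda>i. x i + g a i))
      = N * Q + 2 * (\<Sum>a\<in>R. codisp I x (g a)) + (\<Sum>a\<in>R. codisp I (g a) (g a))"
    by (simp add: codisp_add_self sum.distrib sum_distrib_left Q_def N_def)
  also have "\<dots> \<le> (N - 2 * r) * Q + r * M"
    using first second by (simp add: algebra_simps)
  also have "\<dots> \<le> N * M"
  \<comment> \<open>The sign of the coefficient of \<open>Q\<close> decides. If it is nonnegative,
    \<open>Q \<le> M\<close> leaves (N - r) M; if negative, the term is dropped and
    \<open>r \<le> N\<close> suffices.\<close>
  proof (cases "2 * r \<le> N")
    case True
    then have "(N - 2 * r) * Q \<le> (N - 2 * r) * M" using QM by (intro mult_left_mono) auto
    moreover have "0 \<le> r * M" using nonneg M0 by simp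
    ultimately show ?thesis by (simp add: algebra_simps)
  next
    case False
    then have "(N - 2 * r) * Q \<le> 0" using Q0 by (simp add: mult_le_0_iff)
    moreover have "r * M \<le> N * M" using r M0 by (intro mult_right_mono) (auto simp: N_def)
    ultimately show ?thesis by simp
  qed
  finally have le: "(\<Sum>a\<in>R. codisp I (\<lambda>i. x i + g a i) (\<lambda>i. x i + g a i)) \<le> N * M" .
  assume "\<not> ?thesis"
  then have "(\<Sum>a\<in>R. M) < (\<Sum>a\<in>R. codisp I (\<lambda>i. x i + g a i) (\<lambda>i. x i + g a i))"
    using R by (intro sum_strict_mono) (auto simp: M_def not_le)
  then show False using le by (simp add: N_def)
qed

section \<open>Counting neighbours in the bipartite graph\<close>

text \<open>Edges at \<open>b\<close> biject with its neighbours in \<open>A\<close>: since the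
  sides are disjoint, \<open>b\<close> must be the \<open>B\<close>-end of each such edge.\<close>

lemma degree_bipartite:
  assumes "bipartite_graph A B E" "b \<in> B"
  shows "degree E b = card {a \<in> A. {a, b} \<in> E}"
proof -
  have disj: "A \<inter> B = {}" and E: "\<And>e. e \<in> E \<Longrightarrow> \<exists>a\<in>A. \<exists>b\<in>B. e = {a, b}"
    using assms by (auto simp: bipartite_graph_def)
  have "bij_betw (\<lambda>a. {a, b}) {a \<in> A. {a, b} \<in> E} {e \<in> E. b \<in> e}"
  proof (rule bij_betw_imageI)
    show "inj_on (\<lambda>a. {a, b}) {a \<in> A. {a, b} \<in> E}"
      by (auto simp: inj_on_def doubleton_eq_iff)
    show "(\<lambda>a. {a, b}) ` {a \<in> A. {a, b} \<in> E} = {e \<in> E. b \<in> e}"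
    proof
      show "{e \<in> E. b \<in> e} \<subseteq> (\<lambda>a. {a, b}) ` {a \<in> A. {a, b} \<in> E}"
      proof
        fix e assume e: "e \<in> {e \<in> E. b \<in> e}"
        then obtain a b' where "a \<in> A" "b' \<in> B" "e = {a, b'}" using E by blast
        moreover from this have "b' = b" using e assms(2) disj by auto
        ultimately show "e \<in> (\<lambda>a. {a, b}) ` {a \<in> A. {a, b} \<in> E}" using e by auto
      qed
    qed auto
  qed
  then show ?thesis unfolding degree_def by (simp add: bij_betw_same_card)
qed

lemma card_nbrs_insert:
  assumes "finite T"
  shows "card (nbrs E (insert a S) T) = card (nbrs E S T) + card {b \<in> T - nbrs E S T. {a, b} \<in> E}"
proof -
  have "nbrs E (insert a S) T = nbrs E S T \<union> {b \<in> T - nbrs E S T. {a, b} \<in> E}"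
    by (auto simp: nbrs_def)
  moreover have "finite (nbrs E S T)" using assms by (simp add: nbrs_def)
  ultimately show ?thesis using assms by (simp add: card_Un_disjoint disjoint_iff)
qed

text \<open>Double counting of the edges between \<open>A - S\<close> and the part of
  \<open>T\<close> not yet covered by \<open>S\<close>.\<close>

lemma sum_new_nbrs:
  assumes "finite A" "finite T" and deg: "\<And>b. b \<in> T \<Longrightarrow> card {a \<in> A. {a, b} \<in> E} = r"
  shows "(\<Sum>a\<in>A - S. card {b \<in> T - nbrs E S T. {a, b} \<in> E}) = r * card (T - nbrs E S T)"
proof (rule sum_multicount)
  show "\<forall>b\<in>T - nbrs E S T. card {a \<in> A - S. {a, b} \<in> E} = r"
  proof
    fix b assume b: "b \<in> T - nbrs E S T"
    then have "{a \<in> A - S. {a, b} \<in> E} = {a \<in> A. {a, b} \<in> E}" by (auto simp: nbrs_def)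
    then show "card {a \<in> A - S. {a, b} \<in> E} = r" using b deg by simp
  qed
qed (use assms in auto)

section \<open>From single steps to a chain\<close>

lemma ex_chain_insert:
  assumes "finite A" "P {}"
    and step: "\<And>S. S \<subset> A \<Longrightarrow> P S \<Longrightarrow> \<exists>a\<in>A - S. P (insert a S)"
  shows "\<exists>As :: nat \<Rightarrow> 'a set. As 0 = {} \<and> As (card A) = A \<and>
    (\<forall>j<card A. As j \<subset> As (Suc j)) \<and> (\<forall>j\<le>card A. P (As j))"
proof -
  \<comment> \<open>The choice principle needs an infinite sequence, so the invariant is vacuous
    beyond \<open>card A\<close>. Tracking \<open>card S = j\<close> forces the chain to reach
    \<open>A\<close> exactly at index \<open>card A\<close>.\<close>
  let ?I = "\<lambda>j S. j \<le> card A \<longrightarrow> S \<subseteq> A \<and> card S = j \<and> P S"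
  have "\<exists>As. \<forall>j. ?I j (As j) \<and> (j < card A \<longrightarrow> As j \<subset> As (Suc j))"
  proof (rule dependent_nat_choice)
    show "\<exists>S. ?I 0 S" using assms(2) by (intro exI[of _ "{}"]) simp
  next
    fix S j assume S: "?I j S"
    show "\<exists>S'. ?I (Suc j) S' \<and> (j < card A \<longrightarrow> S \<subset> S')"
    proof (cases "j < card A")
      case True
      then have *: "S \<subset> A" "P S" "card S = j" using S by auto
      then obtain a where a: "a \<in> A - S" "P (insert a S)" using step by blast
      have "finite S" using * assms(1) finite_subset by blast
      then show ?thesis using * a by (intro exI[of _ "insert a S"]) auto
    qed auto
  qed
  then obtain As where
    inv: "\<And>j. j \<le> card A \<Longrightarrow> As j \<subseteq> A \<and> card (As j) = j \<and> P (As j)" and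
    inc: "\<And>j. j < card A \<Longrightarrow> As j \<subset> As (Suc j)" by metis
  have "As 0 = {}"
    using inv[of 0] finite_subset[OF _ assms(1), of "As 0"] by simp
  moreover have "As (card A) = A"
    using inv[of "card A"] card_subset_eq[OF assms(1)] by simp
  ultimately show ?thesis using inv inc by (intro exI[of _ As]) simp
qed

section \<open>Balanced coverage of the blocks\<close>

theorem theorem1p3:
  fixes A B :: "'v set" and E :: "'v set set" and Bl :: "nat \<Rightarrow> 'v set"
    and k m r n :: nat and c :: real
  assumes "k \<ge> 2" and "m \<ge> 1" and "0 < c" and "c < 1/2"
    and "bipartite_graph A B E"
    and "(\<Union>i\<in>{1..k}. Bl i) = B"
    and "disjoint_family_on Bl {1..k}"
    and "\<And>i. i \<in> {1..k} \<Longrightarrow> card (Bl i) = m"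
    and "r \<ge> 1"
    and "\<And>b. b \<in> B \<Longrightarrow> degree E b = r"
    and "\<And>a i. a \<in> A \<Longrightarrow> i \<in> {1..k} \<Longrightarrow> real (card (nbrs E {a} (Bl i))) \<le> c * real m"
    and "n = card A"
  shows "\<exists>As :: nat \<Rightarrow> 'v set.
    {} \<subset> As 1 \<and> (\<forall>j\<in>{1..<n}. As j \<subset> As (Suc j)) \<and> As n = A \<and>
    (\<forall>i1\<in>{1..k}. \<forall>i2\<in>{1..k}. \<forall>j\<in>{1..n}.
      \<bar>real (card (nbrs E (As j) (Bl i1))) - real (card (nbrs E (As j) (Bl i2)))\<bar>
        \<le> sqrt (2 * (real k - 1) * c) * real m)"
proof -
  define x where "x = (\<lambda>S i. real (card (nbrs E S (Bl i))))"
  \<comment> \<open>The bound of the averaging step with \<open>d = c * m\<close>, the largest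
    possible gain in one block.\<close>
  define M where "M = (real k - 1) * (c * real m) * real m"
  let ?I = "{1..k}"
  let ?P = "\<lambda>S. codisp ?I (x S) (x S) \<le> M"
  have fin: "finite A" "finite B"
    using assms(5) by (auto simp: bipartite_graph_def simple_graph_def)
  have finBl: "finite (Bl i)" if "i \<in> ?I" for i
    by (rule finite_subset[OF _ fin(2)]) (use assms(6) that in auto)
  have deg: "card {a \<in> A. {a, b} \<in> E} = r" if "i \<in> ?I" "b \<in> Bl i" for i b
    using that assms(5,6,10) degree_bipartite by (metis UN_I)
  have x_le: "x S i \<le> real m" if "i \<in> ?I" for S i
    unfolding x_def using that finBl[OF that] assms(8)[OF that] card_mono[of "Bl i" "nbrs E S (Bl i)"]
    by (auto simp: nbrs_def)
  have M0: "0 \<le> M" using assms by (simp add: M_def)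
  \<comment> \<open>Needed for \<open>n \<ge> 1\<close>, so that \<open>As 1\<close> lies in the
    chain and is nonempty. A vertex of the first block has positive degree, hence a neighbour in
    \<open>A\<close>.\<close>
  have "A \<noteq> {}"
  proof
    assume "A = {}"
    have "1 \<in> ?I" using assms(1) by simp
    then have "Bl 1 \<noteq> {}" using assms(2,8) by fastforce
    then obtain b where "b \<in> Bl 1" by auto
    then show False using deg[OF \<open>1 \<in> ?I\<close>] \<open>A = {}\<close> assms(9) by fastforce
  qed
  then have n: "1 \<le> n" using fin assms(12) by (simp add: Suc_le_eq card_gt_0_iff)
  have step: "\<exists>a\<in>A - S. ?P (insert a S)" if S: "S \<subset> A" "?P S" for S
  proof -
    define g where "g = (\<lambda>a i. real (card {b \<in> Bl i - nbrs E S (Bl i). {a, b} \<in> E}))"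
    have x_insert: "x (insert a S) i = x S i + g a i" if "i \<in> ?I" for a i
      unfolding x_def g_def using card_nbrs_insert[OF finBl[OF that]] by simp
    have ins: "codisp ?I (x (insert a S)) (x (insert a S))
        = codisp ?I (\<lambda>i. x S i + g a i) (\<lambda>i. x S i + g a i)" for a
      unfolding codisp_def using x_insert by simp
    show ?thesis
    \<comment> \<open>An uncovered vertex has all its \<open>r\<close> neighbours in
      \<open>A - S\<close>, which gives the condition \<open>r \<le> card (A - S)\<close> of the
      averaging step. If none is left, every gain is zero and any new vertex works.\<close>
    proof (cases "\<exists>i\<in>?I. \<exists>b\<in>Bl i. b \<notin> nbrs E S (Bl i)")
      case True
      then obtain i b where b: "i \<in> ?I" "b \<in> Bl i" "b \<notin> nbrs E S (Bl i)" by blast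
      have "{a \<in> A. {a, b} \<in> E} \<subseteq> A - S" using b by (auto simp: nbrs_def)
      then have "card {a \<in> A. {a, b} \<in> E} \<le> card (A - S)"
        using fin by (intro card_mono) auto
      then have r: "real r \<le> real (card (A - S))" using deg[OF b(1,2)] by simp
      have "\<exists>a\<in>A - S. codisp ?I (\<lambda>i. x S i + g a i) (\<lambda>i. x S i + g a i)
          \<le> (real (card ?I) - 1) * (c * real m) * real m"
      proof (rule ex_step_codisp_le[where r = "real r"])
        fix a i assume a: "a \<in> A - S" and i: "i \<in> ?I"
        have "{b \<in> Bl i - nbrs E S (Bl i). {a, b} \<in> E} \<subseteq> nbrs E {a} (Bl i)"
          by (auto simp: nbrs_def)
        moreover have "finite (nbrs E {a} (Bl i))" using finBl[OF i] by (simp add: nbrs_def)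
        ultimately have "g a i \<le> real (card (nbrs E {a} (Bl i)))"
          by (simp add: g_def card_mono)
        then show "g a i \<le> c * real m" using assms(11)[of a i] a i by simp
      next
        fix i assume i: "i \<in> ?I"
        have "(\<Sum>a\<in>A - S. g a i) = real (r * card (Bl i - nbrs E S (Bl i)))"
          unfolding g_def of_nat_sum[symmetric]
          by (subst sum_new_nbrs[OF fin(1) finBl[OF i] deg[OF i]]) simp_all
        \<comment> \<open>This subtraction is on naturals; the bound by \<open>m\<close> that
          follows lets it become the real difference \<open>m - x S i\<close>.\<close>
        moreover have "card (Bl i - nbrs E S (Bl i)) = m - card (nbrs E S (Bl i))"
          using card_Diff_subset[of "nbrs E S (Bl i)" "Bl i"] finBl[OF i] assms(8)[OF i]
          by (auto simp: nbrs_def)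
        moreover have "card (nbrs E S (Bl i)) \<le> m" using x_le[OF i] by (simp add: x_def)
        ultimately show "(\<Sum>a\<in>A - S. g a i) = real r * (real m - x S i)"
          by (simp add: x_def of_nat_diff)
      next
        show "A - S \<noteq> {}" using S(1) by blast
        show "codisp ?I (x S) (x S) \<le> (real (card ?I) - 1) * (c * real m) * real m"
          using S(2) by (simp add: M_def)
      qed (use assms(1,3) fin r in \<open>simp_all add: g_def x_def\<close>)
      then show ?thesis unfolding ins by (simp add: M_def)
    next
      case False
      then have "g a i = 0" if "i \<in> ?I" for a i
      proof -
        have "{b \<in> Bl i - nbrs E S (Bl i). {a, b} \<in> E} = {}" using False that by blast
        then show ?thesis unfolding g_def by (simp only: card.empty of_nat_0)
      qed
      then have "codisp ?I (x (insert a S)) (x (insert a S)) = codisp ?I (x S) (x S)" for a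
        unfolding ins by (simp add: codisp_def)
      moreover obtain a where "a \<in> A - S" using S(1) by blast
      ultimately show ?thesis using S(2) by metis
    qed
  qed
  have "?P {}" using M0 by (simp add: codisp_def x_def nbrs_def)
  from ex_chain_insert[where P = ?P, OF fin(1) this step]
  obtain As where As: "As 0 = {}" "As n = A" "\<And>j. j < n \<Longrightarrow> As j \<subset> As (Suc j)"
    "\<And>j. j \<le> n \<Longrightarrow> ?P (As j)"
    unfolding assms(12) by blast
  have "\<bar>x (As j) p - x (As j) q\<bar> \<le> sqrt (2 * (real k - 1) * c) * real m"
    if "p \<in> ?I" "q \<in> ?I" "j \<le> n" for p q j
  proof -
    have "(x (As j) p - x (As j) q)\<^sup>2 \<le> 2 * M"
      using diff_squared_le_codisp[of ?I p q "x (As j)"] As(4)[OF that(3)] that by simp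
    then have "\<bar>x (As j) p - x (As j) q\<bar> \<le> sqrt (2 * M)"
      by (metis real_sqrt_abs real_sqrt_le_mono)
    also have "2 * M = 2 * (real k - 1) * c * (real m)\<^sup>2"
      by (simp add: M_def power2_eq_square)
    finally show ?thesis by (simp add: real_sqrt_mult)
  qed
  \<comment> \<open>The chain starts at index 0 with the empty set, so its first strict inclusion
    makes \<open>As 1\<close> nonempty.\<close>
  moreover have "{} \<subset> As 1" using As(1) As(3)[of 0] n by simp
  ultimately show ?thesis
    using As(2,3) unfolding x_def by (intro exI[of _ As]) simp
qed

end
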